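(* Consider the recurrence $$\begin{aligned}&\tau_{n+7}\tau_{n+4}^2\tau_{n+3}^3\tau_{n+2}^2+\tau_{n+6}^2\tau_{n+3}^4\tau_{n+2}^2+2\tau_{n+6}\tau_{n+5}^2\tau_{n+3}^2\tau_{n+2}^3+\tau_{n+6}\tau_{n+5}\tau_{n+4}^2\tau_{n+3}^2\tau_{n+2}\tau_{n+1}\\&+\tau_{n+5}^4\tau_{n+2}^4+2\tau_{n+5}^3\tau_{n+4}^2\tau_{n+2}^2\tau_{n+1}+\tau_{n+5}^2\tau_{n+4}^4\tau_{n+1}^2+\tau_{n+5}^2\tau_{n+4}^3\tau_{n+3}^2\tau_n\\&+\nu(\tau_{n+6}\tau_{n+5}\tau_{n+4}\tau_{n+3}^3\tau_{n+2}^2+\tau_{n+5}^3\tau_{n+4}\tau_{n+3}\tau_{n+2}^3+\tau_{n+5}^2\tau_{n+4}^3\tau_{n+3}\tau_{n+2}\tau_{n+1})\\&+b\,\tau_{n+5}^2\tau_{n+4}^2\tau_{n+3}^2\tau_{n+2}^2+a\,\tau_{n+5}\tau_{n+4}^3\tau_{n+3}^3\tau_{n+2}=0,\end{aligned}$$ with $a,b,\nu$ and the initial values $\tau_0,\dots,\tau_6$ regarded as independent indeterminates. It has the Laurent property; more precisely, for all $n\in\mathbb{Z}$, $$\tau_n\in\mathbb{Z}[a,b,\nu,\tau_0,\tau_1,\tau_2^{\pm1},\tau_3^{\pm1},\tau_4^{\pm1},\tau_5,\tau_6].$$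
   Context: The recurrence is linear in $\tau_{n+7}$ and in $\tau_n$, so solving it for $\tau_{n+7}$ (respectively for $\tau_n$) defines all $\tau_n$, $n\in\mathbb{Z}$, as elements of the field $\mathbb{Q}(a,b,\nu,\tau_0,\dots,\tau_6)$. *)

theory Defs
  imports "HOL-Computational_Algebra.Computational_Algebra"
begin

text \<open>
  The polynomial ring in ten indeterminates over the integers, as an iterated univariate
  polynomial ring. From the innermost to the outermost level, the variables are
  \<open>a, b, \<nu>, \<tau>\<^sub>0, \<dots>, \<tau>\<^sub>6\<close>. Its fraction field is the field of rational functions
  \<open>\<rat>(a, b, \<nu>, \<tau>\<^sub>0, \<dots>, \<tau>\<^sub>6)\<close>.
\<close>

type_synonym poly_ring =
  "int poly poly poly poly poly poly poly poly poly poly"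

type_synonym rat_funs = "poly_ring fract"

text \<open>
  In each definition, the innermost \<open>[:0, 1:]\<close> is the variable of its level, and
  each surrounding \<open>[:_:]\<close> embeds it as a constant polynomial one level further out.
\<close>

definition X_a :: rat_funs where
  "X_a = to_fract [:[:[:[:[:[:[:[:[:[:0, 1:]:]:]:]:]:]:]:]:]:]"

definition X_b :: rat_funs where
  "X_b = to_fract [:[:[:[:[:[:[:[:[:0, 1:]:]:]:]:]:]:]:]:]"

definition X_nu :: rat_funs where
  "X_nu = to_fract [:[:[:[:[:[:[:[:0, 1:]:]:]:]:]:]:]:]"

definition X_tau0 :: rat_funs where
  "X_tau0 = to_fract [:[:[:[:[:[:[:0, 1:]:]:]:]:]:]:]"

definition X_tau1 :: rat_funs where
  "X_tau1 = to_fract [:[:[:[:[:[:0, 1:]:]:]:]:]:]"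

definition X_tau2 :: rat_funs where
  "X_tau2 = to_fract [:[:[:[:[:0, 1:]:]:]:]:]"

definition X_tau3 :: rat_funs where
  "X_tau3 = to_fract [:[:[:[:0, 1:]:]:]:]"

definition X_tau4 :: rat_funs where
  "X_tau4 = to_fract [:[:[:0, 1:]:]:]"

definition X_tau5 :: rat_funs where
  "X_tau5 = to_fract [:[:0, 1:]:]"

definition X_tau6 :: rat_funs where
  "X_tau6 = to_fract [:0, 1:]"

definition recurrence_lhs :: "'a::comm_ring_1 \<Rightarrow> 'a \<Rightarrow> 'a \<Rightarrow> (int \<Rightarrow> 'a) \<Rightarrow> int \<Rightarrow> 'a" where
  "recurrence_lhs a b \<nu> \<tau> n =
     \<tau> (n+7) * \<tau> (n+4)^2 * \<tau> (n+3)^3 * \<tau> (n+2)^2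
   + \<tau> (n+6)^2 * \<tau> (n+3)^4 * \<tau> (n+2)^2
   + 2 * \<tau> (n+6) * \<tau> (n+5)^2 * \<tau> (n+3)^2 * \<tau> (n+2)^3
   + \<tau> (n+6) * \<tau> (n+5) * \<tau> (n+4)^2 * \<tau> (n+3)^2 * \<tau> (n+2) * \<tau> (n+1)
   + \<tau> (n+5)^4 * \<tau> (n+2)^4
   + 2 * \<tau> (n+5)^3 * \<tau> (n+4)^2 * \<tau> (n+2)^2 * \<tau> (n+1)
   + \<tau> (n+5)^2 * \<tau> (n+4)^4 * \<tau> (n+1)^2
   + \<tau> (n+5)^2 * \<tau> (n+4)^3 * \<tau> (n+3)^2 * \<tau> n
   + \<nu> * (\<tau> (n+6) * \<tau> (n+5) * \<tau> (n+4) * \<tau> (n+3)^3 * \<tau> (n+2)^2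
        + \<tau> (n+5)^3 * \<tau> (n+4) * \<tau> (n+3) * \<tau> (n+2)^3
        + \<tau> (n+5)^2 * \<tau> (n+4)^3 * \<tau> (n+3) * \<tau> (n+2) * \<tau> (n+1))
   + b * \<tau> (n+5)^2 * \<tau> (n+4)^2 * \<tau> (n+3)^2 * \<tau> (n+2)^2
   + a * \<tau> (n+5) * \<tau> (n+4)^3 * \<tau> (n+3)^3 * \<tau> (n+2)"

definition tau_sequence :: "(int \<Rightarrow> rat_funs) \<Rightarrow> bool" where
  "tau_sequence \<tau> \<longleftrightarrow>
     \<tau> 0 = X_tau0 \<and> \<tau> 1 = X_tau1 \<and> \<tau> 2 = X_tau2 \<and> \<tau> 3 = X_tau3 \<and>
     \<tau> 4 = X_tau4 \<and> \<tau> 5 = X_tau5 \<and> \<tau> 6 = X_tau6 \<and>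
     (\<forall>n. recurrence_lhs X_a X_b X_nu \<tau> n = 0)"

inductive_set subring_generated :: "'a::comm_ring_1 set \<Rightarrow> 'a set" for S where
  gen: "x \<in> S \<Longrightarrow> x \<in> subring_generated S"
| one: "1 \<in> subring_generated S"
| diff: "x \<in> subring_generated S \<Longrightarrow> y \<in> subring_generated S \<Longrightarrow> x - y \<in> subring_generated S"
| mult: "x \<in> subring_generated S \<Longrightarrow> y \<in> subring_generated S \<Longrightarrow> x * y \<in> subring_generated S"

definition laurent_ring :: "rat_funs set" where
  "laurent_ring = subring_generated
     {X_a, X_b, X_nu, X_tau0, X_tau1,
      X_tau2, inverse X_tau2, X_tau3, inverse X_tau3, X_tau4, inverse X_tau4,
      X_tau5, X_tau6}"

end

theory Submission
  imports Defs
begin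

text \<open>
  Existence and uniqueness: at \<open>a = -10\<close>, \<open>b = \<nu> = 0\<close>, \<open>\<tau>\<^sub>0 = \<dots> = \<tau>\<^sub>6 = 1\<close> the
  recurrence is solved by the constant sequence \<open>1\<close>, so all iterates of the generic solution
  specialise to \<open>1\<close> and in particular do not vanish.

  Laurent property: near \<open>\<tau>\<^sub>5 = 0\<close> the singularity is confined. The quantities
  \<open>C = (\<tau>\<^sub>7 \<tau>\<^sub>4\<^sup>2 + \<tau>\<^sub>6\<^sup>2 \<tau>\<^sub>3) / \<tau>\<^sub>5\<close> and
  \<open>F = (\<tau>\<^sub>8 \<tau>\<^sub>4\<^sup>3 + C\<^sup>2 + \<tau>\<^sub>6\<^sup>3 \<tau>\<^sub>2 + \<nu> \<tau>\<^sub>6 \<tau>\<^sub>4 C + b \<tau>\<^sub>6\<^sup>2 \<tau>\<^sub>4\<^sup>2) / \<tau>\<^sub>5\<^sup>2\<close>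
  are Laurent polynomials with denominators in \<open>\<tau>\<^sub>2, \<tau>\<^sub>3, \<tau>\<^sub>4\<close> only, and in terms of them
  all powers of \<open>\<tau>\<^sub>5\<close> cancel from the denominators of \<open>\<tau>\<^sub>7, \<dots>, \<tau>\<^sub>1\<^sub>0\<close>. For larger
  \<open>n\<close>, expressing \<open>\<tau>\<^sub>n\<close> through the window starting at \<open>\<tau>\<^sub>1\<close> leaves only \<open>\<tau>\<^sub>5\<close> as an
  extra denominator, while the window starting at \<open>\<tau>\<^sub>4\<close> leaves only \<open>\<tau>\<^sub>6 \<tau>\<^sub>7 \<tau>\<^sub>8\<close>, which is
  prime to \<open>\<tau>\<^sub>5\<close>; hence neither occurs. Negative \<open>n\<close> follow by the symmetry
  \<open>n \<mapsto> 6 - n\<close>.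
\<close>

section \<open>Evaluation of iterated polynomials\<close>

definition is_hom :: "('a::comm_ring_1 \<Rightarrow> 'b::comm_ring_1) \<Rightarrow> bool" where
  "is_hom h \<longleftrightarrow> h 1 = 1 \<and> (\<forall>x y. h (x + y) = h x + h y) \<and> (\<forall>x y. h (x * y) = h x * h y)"

lemma is_hom_one: "is_hom h \<Longrightarrow> h 1 = 1"
  and is_hom_add: "is_hom h \<Longrightarrow> h (x + y) = h x + h y"
  and is_hom_mult: "is_hom h \<Longrightarrow> h (x * y) = h x * h y"
  by (auto simp: is_hom_def)

lemma is_hom_zero: "is_hom h \<Longrightarrow> h 0 = 0"
  using is_hom_add[of h 0 0] by simp

lemma is_hom_minus: "is_hom h \<Longrightarrow> h (- x) = - h x"
  using is_hom_add[of h x "- x"] by (simp add: is_hom_zero eq_neg_iff_add_eq_0 add.commute)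

lemma is_hom_diff: "is_hom h \<Longrightarrow> h (x - y) = h x - h y"
  using is_hom_add[of h x "- y"] by (simp add: is_hom_minus)

lemma is_hom_power: "is_hom h \<Longrightarrow> h (x ^ n) = h x ^ n"
  by (induction n) (simp_all add: is_hom_one is_hom_mult)

lemma is_hom_of_nat: "is_hom h \<Longrightarrow> h (of_nat n) = of_nat n"
  by (induction n) (simp_all add: is_hom_one is_hom_zero is_hom_add)

lemma is_hom_of_int: "is_hom h \<Longrightarrow> h (of_int n) = of_int n"
  by (cases n rule: int_cases2) (simp_all add: is_hom_of_nat is_hom_minus)

lemma is_hom_numeral: "is_hom h \<Longrightarrow> h (numeral n) = numeral n"
  using is_hom_of_nat[of h "numeral n"] by simp

lemmas is_hom_simps = is_hom_one is_hom_zero is_hom_add is_hom_mult is_hom_minus is_hom_diff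
  is_hom_power is_hom_numeral

definition eval_with :: "('a::comm_ring_1 \<Rightarrow> 'b::comm_ring_1) \<Rightarrow> 'b \<Rightarrow> 'a poly \<Rightarrow> 'b" where
  "eval_with h x p = poly (map_poly h p) x"

lemma eval_with_pCons: "is_hom h \<Longrightarrow> eval_with h x (pCons c p) = h c + x * eval_with h x p"
  by (simp add: eval_with_def map_poly_pCons is_hom_zero)

lemma eval_with_0 [simp]: "eval_with h x 0 = 0"
  by (simp add: eval_with_def)

lemma eval_with_const: "is_hom h \<Longrightarrow> eval_with h x [:c:] = h c"
  by (simp add: eval_with_pCons)

lemma eval_with_var: "is_hom h \<Longrightarrow> eval_with h x [:0, 1:] = x"
  by (simp add: eval_with_pCons is_hom_zero is_hom_one)

lemma is_hom_eval_with:
  assumes h: "is_hom h"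
  shows "is_hom (eval_with h x)"
proof -
  have add: "eval_with h x (p + q) = eval_with h x p + eval_with h x q" for p q
    by (induction p q rule: poly_induct2)
       (simp_all add: eval_with_pCons[OF h] is_hom_add[OF h] algebra_simps)
  have smult: "eval_with h x (smult c q) = h c * eval_with h x q" for c q
    by (induction q)
       (simp_all add: eval_with_pCons[OF h] is_hom_mult[OF h] algebra_simps)
  have mult: "eval_with h x (p * q) = eval_with h x p * eval_with h x q" for p q
    by (induction p)
       (simp_all add: eval_with_pCons[OF h] add smult is_hom_zero[OF h] algebra_simps)
  show ?thesis
    using add mult eval_with_const[OF h, of x 1] is_hom_one[OF h]
    by (simp add: is_hom_def flip: one_pCons)
qed

text \<open>The universal property of a univariate polynomial ring: coefficients together with the
  image of the variable determine a homomorphism.\<close>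

lemma eval_with_unique:
  assumes phi: "is_hom \<phi>" and h: "is_hom h"
    and "\<And>c. \<phi> [:c:] = h c" and "\<phi> [:0, 1:] = x"
  shows "eval_with h x p = \<phi> p"
proof (induction p)
  case 0
  show ?case by (simp add: is_hom_zero[OF phi])
next
  case (pCons c p)
  have "\<phi> (pCons c p) = \<phi> ([:c:] + [:0, 1:] * p)"
    by simp
  also have "\<dots> = h c + x * \<phi> p"
    using assms by (simp only: is_hom_add is_hom_mult)
  finally show ?case
    using pCons by (simp add: eval_with_pCons[OF h])
qed

lemma is_hom_of_int_fun: "is_hom of_int"
  by (simp add: is_hom_def)

text \<open>The nesting follows \<open>poly_ring\<close>, with \<open>a\<close> innermost and
  \<open>\<tau> 6\<close> outermost. The argument is a whole sequence so that shifted and reflected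
  solutions can be substituted, although only the entries 0 to 6 are read.\<close>

definition ev :: "'a::comm_ring_1 \<Rightarrow> 'a \<Rightarrow> 'a \<Rightarrow> (int \<Rightarrow> 'a) \<Rightarrow> poly_ring \<Rightarrow> 'a" where
  "ev a b \<nu> \<tau> =
     eval_with (eval_with (eval_with (eval_with (eval_with (eval_with (eval_with
       (eval_with (eval_with (eval_with of_int a) b) \<nu>)
       (\<tau> 0)) (\<tau> 1)) (\<tau> 2)) (\<tau> 3)) (\<tau> 4)) (\<tau> 5)) (\<tau> 6)"

lemma is_hom_ev: "is_hom (ev a b \<nu> \<tau>)"
  unfolding ev_def by (intro is_hom_eval_with is_hom_of_int_fun)

lemmas ev_simps = is_hom_simps[OF is_hom_ev]

section \<open>The indeterminates and the prime \<open>P_tau 5\<close>\<close>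

definition P_a :: poly_ring where "P_a = [:[:[:[:[:[:[:[:[:[:0, 1:]:]:]:]:]:]:]:]:]:]"
definition P_b :: poly_ring where "P_b = [:[:[:[:[:[:[:[:[:0, 1:]:]:]:]:]:]:]:]:]"
definition P_nu :: poly_ring where "P_nu = [:[:[:[:[:[:[:[:0, 1:]:]:]:]:]:]:]:]"

definition P_tau :: "int \<Rightarrow> poly_ring" where
  "P_tau i = (if i = 0 then [:[:[:[:[:[:[:0, 1:]:]:]:]:]:]:]
    else if i = 1 then [:[:[:[:[:[:0, 1:]:]:]:]:]:]
    else if i = 2 then [:[:[:[:[:0, 1:]:]:]:]:]
    else if i = 3 then [:[:[:[:0, 1:]:]:]:]
    else if i = 4 then [:[:[:0, 1:]:]:]
    else if i = 5 then [:[:0, 1:]:]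
    else [:0, 1:])"

lemma int_0_6_cases:
  assumes "0 \<le> i" "i \<le> (6::int)"
  shows "i = 0 \<or> i = 1 \<or> i = 2 \<or> i = 3 \<or> i = 4 \<or> i = 5 \<or> i = 6"
  using assms by linarith

lemma ev_P_a: "ev a b \<nu> \<tau> P_a = a"
  and ev_P_b: "ev a b \<nu> \<tau> P_b = b"
  and ev_P_nu: "ev a b \<nu> \<tau> P_nu = \<nu>"
  unfolding ev_def P_a_def P_b_def P_nu_def
  by (simp_all add: eval_with_const eval_with_var is_hom_eval_with is_hom_of_int_fun
      del: pCons_one)

lemma ev_P_tau:
  assumes "0 \<le> i" "i \<le> 6"
  shows "ev a b \<nu> \<tau> (P_tau i) = \<tau> i"
  using int_0_6_cases[OF assms] unfolding ev_def P_tau_def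
  by (elim disjE)
     (simp_all add: eval_with_const eval_with_var is_hom_eval_with is_hom_of_int_fun
      del: pCons_one)

lemma is_hom_to_fract: "is_hom (to_fract :: 'a::idom \<Rightarrow> 'a fract)"
  by (simp add: is_hom_def)

lemma is_hom_comp_const: "is_hom \<phi> \<Longrightarrow> is_hom (\<lambda>c. \<phi> [:c:])"
proof -
  assume phi: "is_hom \<phi>"
  have "\<phi> [:x + y:] = \<phi> [:x:] + \<phi> [:y:]" "\<phi> [:x * y:] = \<phi> [:x:] * \<phi> [:y:]" for x y
    using is_hom_add[OF phi, of "[:x:]" "[:y:]"] is_hom_mult[OF phi, of "[:x:]" "[:y:]"]
    by (simp_all add: mult.commute)
  then show ?thesis
    using is_hom_one[OF phi] by (simp add: is_hom_def flip: one_pCons)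
qed

lemma eval_with_unique':
  assumes "is_hom \<phi>" and "h = (\<lambda>c. \<phi> [:c:])" and "x = \<phi> [:0, 1:]"
  shows "eval_with h x = \<phi>"
  using assms by (intro ext eval_with_unique) (simp_all add: is_hom_comp_const)

text \<open>Uniqueness of evaluation is applied at each of the ten levels.\<close>

lemma ev_generic:
  assumes "\<And>i. 0 \<le> i \<Longrightarrow> i \<le> 6 \<Longrightarrow> \<tau> i = to_fract (P_tau i)"
  shows "ev X_a X_b X_nu \<tau> = to_fract"
  unfolding ev_def
  apply (intro eval_with_unique' is_hom_comp_const is_hom_to_fract)
  apply (simp_all add: assms P_tau_def X_a_def X_b_def X_nu_def del: pCons_one)
  \<comment> \<open>At the bottom level remains the fact that the only homomorphism from the
    integers is \<open>of_int\<close>.\<close>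
  apply (rule ext)
  subgoal for n
    using is_hom_of_int[OF is_hom_comp_const[OF is_hom_comp_const[OF is_hom_comp_const[OF
      is_hom_comp_const[OF is_hom_comp_const[OF is_hom_comp_const[OF is_hom_comp_const[OF
      is_hom_comp_const[OF is_hom_comp_const[OF is_hom_comp_const[OF
      is_hom_to_fract[where 'a = poly_ring]]]]]]]]]]],
      of n] by simp
  done

text \<open>A variable divides exactly the polynomials that vanish at 0, and primes stay prime as
  constants one level further out.\<close>

lemma prime_P_tau5: "prime_elem (P_tau 5)"
proof -
  have X: "prime_elem ([:0, 1:] :: 'a::idom poly)"
  proof (rule prime_elemI)
    show "([:0, 1:] :: 'a poly) \<noteq> 0" by simp
    show "\<not> ([:0, 1:] :: 'a poly) dvd 1"
      using poly_eq_0_iff_dvd[of "1 :: 'a poly" 0] by simp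
    fix p q :: "'a poly"
    assume "[:0, 1:] dvd p * q"
    then show "[:0, 1:] dvd p \<or> [:0, 1:] dvd q"
      using poly_eq_0_iff_dvd[of "p * q" 0] poly_eq_0_iff_dvd[of p 0] poly_eq_0_iff_dvd[of q 0]
      by simp
  qed
  show ?thesis
    unfolding P_tau_def using X by (simp add: prime_elem_const_poly_iff del: pCons_one)
qed

text \<open>One point of the hyperplane \<open>\<tau> 5 = 0\<close> where \<open>p\<close> does not
  vanish certifies that \<open>p\<close> is not divisible.\<close>

lemma not_P_tau5_dvd:
  assumes "ev a b \<nu> \<tau> p \<noteq> 0" and "\<tau> 5 = 0"
  shows "\<not> P_tau 5 dvd p"
  using assms by (auto simp: ev_simps ev_P_tau elim!: dvdE)

section \<open>The generic solution\<close>

definition tau_den :: "'a::comm_ring_1 \<Rightarrow> 'a \<Rightarrow> 'a \<Rightarrow> 'a" where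
  "tau_den x2 x3 x4 = x4^2 * x3^3 * x2^2"

definition tau_rest :: "'a::comm_ring_1 \<Rightarrow> 'a \<Rightarrow> 'a \<Rightarrow>
    'a \<Rightarrow> 'a \<Rightarrow> 'a \<Rightarrow> 'a \<Rightarrow> 'a \<Rightarrow> 'a \<Rightarrow> 'a \<Rightarrow> 'a" where
  "tau_rest a b \<nu> x0 x1 x2 x3 x4 x5 x6 =
     x6^2 * x3^4 * x2^2 + 2 * x6 * x5^2 * x3^2 * x2^3 + x6 * x5 * x4^2 * x3^2 * x2 * x1
   + x5^4 * x2^4 + 2 * x5^3 * x4^2 * x2^2 * x1 + x5^2 * x4^4 * x1^2 + x5^2 * x4^3 * x3^2 * x0
   + \<nu> * (x6 * x5 * x4 * x3^3 * x2^2 + x5^3 * x4 * x3 * x2^3 + x5^2 * x4^3 * x3 * x2 * x1)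
   + b * x5^2 * x4^2 * x3^2 * x2^2 + a * x5 * x4^3 * x3^3 * x2"

lemma recurrence_lhs_eq:
  "recurrence_lhs a b \<nu> \<tau> n = \<tau> (n+7) * tau_den (\<tau> (n+2)) (\<tau> (n+3)) (\<tau> (n+4))
     + tau_rest a b \<nu> (\<tau> n) (\<tau> (n+1)) (\<tau> (n+2)) (\<tau> (n+3)) (\<tau> (n+4)) (\<tau> (n+5)) (\<tau> (n+6))"
  by (simp add: recurrence_lhs_def tau_den_def tau_rest_def mult.assoc add.assoc)

lemma recurrence_lhs_cong:
  assumes "\<And>i. n \<le> i \<Longrightarrow> i \<le> n + 7 \<Longrightarrow> \<tau> i = \<tau>' i"
  shows "recurrence_lhs a b \<nu> \<tau> n = recurrence_lhs a b \<nu> \<tau>' n"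
  by (simp add: recurrence_lhs_eq assms)

lemma recurrence_lhs_shift:
  "recurrence_lhs a b \<nu> (\<lambda>i. \<tau> (i + j)) n = recurrence_lhs a b \<nu> \<tau> (n + j)"
  by (simp add: recurrence_lhs_def ac_simps)

text \<open>Reversing the eight indices permutes the monomials: the first and eighth, second and
  seventh, third and sixth, and the outer two behind \<nu> are exchanged, while all others are
  fixed.\<close>

lemma recurrence_lhs_reflect:
  "recurrence_lhs a b \<nu> (\<lambda>i. \<tau> (6 - i)) n = recurrence_lhs a b \<nu> \<tau> (- n - 1)"
proof -
  have idx: "6 - (n + 7) = - n - 1" "6 - (n + 6) = - n - 1 + 1" "6 - (n + 5) = - n - 1 + 2"
    "6 - (n + 4) = - n - 1 + 3" "6 - (n + 3) = - n - 1 + 4" "6 - (n + 2) = - n - 1 + 5"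
    "6 - (n + 1) = - n - 1 + 6" "6 - n = - n - 1 + 7"
    by simp_all
  show ?thesis
    unfolding recurrence_lhs_def idx by (simp only: ac_simps distrib_left)
qed

lemma recurrence_unique_forward:
  fixes \<tau> \<tau>' :: "int \<Rightarrow> 'a::field"
  assumes "\<And>n. recurrence_lhs a b \<nu> \<tau> n = 0" "\<And>n. recurrence_lhs a b \<nu> \<tau>' n = 0"
    and "\<And>n. \<tau> n \<noteq> 0" and init: "\<And>i. 0 \<le> i \<Longrightarrow> i \<le> 6 \<Longrightarrow> \<tau> i = \<tau>' i"
  shows "\<tau> (int n) = \<tau>' (int n)"
proof (induction n rule: less_induct)
  case (less n)
  show ?case
  proof (cases "n < 7")
    case True
    then show ?thesis using init by simp
  next
    case False
    then obtain k where n: "n = k + 7"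
      by (metis add.commute le_Suc_ex not_less)
    have IH: "\<tau> (int k + i) = \<tau>' (int k + i)" if "0 \<le> i" "i < 7" for i
      using less[of "k + nat i"] that n by simp
    \<comment> \<open>By induction both solutions share the leading coefficient and the remaining
      terms, so the two recurrences differ only in the top entry.\<close>
    have "\<tau> (int k + 7) * tau_den (\<tau> (int k + 2)) (\<tau> (int k + 3)) (\<tau> (int k + 4)) =
      \<tau>' (int k + 7) * tau_den (\<tau> (int k + 2)) (\<tau> (int k + 3)) (\<tau> (int k + 4))"
      using assms(1)[of "int k"] assms(2)[of "int k"] IH[of 0] IH
      by (simp add: recurrence_lhs_eq add_eq_0_iff2)
    then show ?thesis
      using assms(3) n by (simp add: tau_den_def add.commute)
  qed
qed

lemma recurrence_unique:
  fixes \<tau> \<tau>' :: "int \<Rightarrow> 'a::field"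
  assumes "\<And>n. recurrence_lhs a b \<nu> \<tau> n = 0" "\<And>n. recurrence_lhs a b \<nu> \<tau>' n = 0"
    and "\<And>n. \<tau> n \<noteq> 0" and "\<And>i. 0 \<le> i \<Longrightarrow> i \<le> 6 \<Longrightarrow> \<tau> i = \<tau>' i"
  shows "\<tau> = \<tau>'"
proof
  fix n
  show "\<tau> n = \<tau>' n"
  proof (cases "n \<ge> 0")
    case True
    then show ?thesis
      using recurrence_unique_forward[OF assms, of "nat n"] by simp
  next
    case False
    \<comment> \<open>Reflection maps the initial window 0 to 6 onto itself and turns negative
      indices into positive ones.\<close>
    then show ?thesis
      using recurrence_unique_forward[of a b \<nu> "\<lambda>i. \<tau> (6 - i)" "\<lambda>i. \<tau>' (6 - i)" "nat (6 - n)"] assms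
      by (simp add: recurrence_lhs_reflect)
  qed
qed

section \<open>Specialisation at the base point, and non-vanishing\<close>

definition base_value :: "poly_ring \<Rightarrow> int" where
  "base_value = ev (- 10) 0 0 (\<lambda>_. 1)"

lemma is_hom_base_value: "is_hom base_value"
  by (simp add: base_value_def is_hom_ev)

lemmas base_value_simps = is_hom_simps[OF is_hom_base_value]

text \<open>Restricting to denominators that do not vanish at the base point makes the value
  well defined.\<close>

definition specialises_to :: "rat_funs \<Rightarrow> int \<Rightarrow> bool" where
  "specialises_to x v \<longleftrightarrow> (\<exists>p q. base_value q \<noteq> 0 \<and> x * to_fract q = to_fract p \<and>
     base_value p = v * base_value q)"

lemma specialises_to_fract: "base_value p = v \<Longrightarrow> specialises_to (to_fract p) v"
  unfolding specialises_to_def by (rule exI[of _ p], rule exI[of _ 1]) (simp add: base_value_simps)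

lemma specialises_to_params:
  "specialises_to X_a (- 10)" "specialises_to X_b 0" "specialises_to X_nu 0"
  using specialises_to_fract[of P_a] specialises_to_fract[of P_b] specialises_to_fract[of P_nu]
  unfolding base_value_def ev_P_a ev_P_b ev_P_nu
  by (simp_all add: X_a_def X_b_def X_nu_def P_a_def P_b_def P_nu_def)

lemma specialises_to_add:
  assumes "specialises_to x v" "specialises_to y w"
  shows "specialises_to (x + y) (v + w)"
proof -
  obtain p q p' q' where *: "base_value q \<noteq> 0" "x * to_fract q = to_fract p"
    "base_value p = v * base_value q" "base_value q' \<noteq> 0" "y * to_fract q' = to_fract p'"
    "base_value p' = w * base_value q'"
    using assms unfolding specialises_to_def by blast
  have "(x + y) * to_fract (q * q') = (x * to_fract q) * to_fract q' + (y * to_fract q') * to_fract q"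
    by (simp add: algebra_simps)
  then have "(x + y) * to_fract (q * q') = to_fract (p * q' + p' * q)"
    using * by simp
  moreover have "base_value (p * q' + p' * q) = (v + w) * base_value (q * q')"
    using * by (simp add: base_value_simps algebra_simps)
  moreover have "base_value (q * q') \<noteq> 0"
    using * by (simp add: base_value_simps)
  ultimately show ?thesis
    unfolding specialises_to_def by blast
qed

lemma specialises_to_mult:
  assumes "specialises_to x v" "specialises_to y w"
  shows "specialises_to (x * y) (v * w)"
proof -
  obtain p q p' q' where *: "base_value q \<noteq> 0" "x * to_fract q = to_fract p"
    "base_value p = v * base_value q" "base_value q' \<noteq> 0" "y * to_fract q' = to_fract p'"
    "base_value p' = w * base_value q'"
    using assms unfolding specialises_to_def by blast
  have "(x * y) * to_fract (q * q') = (x * to_fract q) * (y * to_fract q')"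
    by (simp add: algebra_simps)
  then have "(x * y) * to_fract (q * q') = to_fract (p * p')"
    using * by simp
  moreover have "base_value (p * p') = (v * w) * base_value (q * q')"
    using * by (simp add: base_value_simps algebra_simps)
  moreover have "base_value (q * q') \<noteq> 0"
    using * by (simp add: base_value_simps)
  ultimately show ?thesis
    unfolding specialises_to_def by blast
qed

lemma specialises_to_numeral: "specialises_to (numeral n) (numeral n)"
  using specialises_to_fract[of "numeral n" "numeral n"] by (simp add: base_value_simps is_hom_numeral[OF is_hom_to_fract])

lemma specialises_to_uminus: "specialises_to x v \<Longrightarrow> specialises_to (- x) (- v)"
  using specialises_to_mult[OF specialises_to_fract[of "- 1" "- 1"], of x v]
  by (simp add: base_value_simps is_hom_minus[OF is_hom_to_fract])

lemma specialises_to_power: "specialises_to x v \<Longrightarrow> specialises_to (x ^ n) (v ^ n)"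
  using specialises_to_fract[of 1 1]
  by (induction n) (simp_all add: base_value_simps specialises_to_mult)

lemma specialises_to_one_nonzero: "specialises_to x 1 \<Longrightarrow> x \<noteq> 0"
  by (auto simp: specialises_to_def base_value_simps)

text \<open>Values are integers, so inversion is limited to value 1: there numerator and denominator
  have the same nonzero base value and may be swapped.\<close>

lemma specialises_to_divide:
  assumes "specialises_to x v" "specialises_to y 1"
  shows "specialises_to (x / y) v"
proof -
  obtain p q where *: "base_value q \<noteq> 0" "y * to_fract q = to_fract p" "base_value p = base_value q"
    using assms(2) unfolding specialises_to_def by auto
  have "inverse y * to_fract p = to_fract q"
    using * specialises_to_one_nonzero[OF assms(2)] by (simp add: field_simps)
  with * have "specialises_to (inverse y) 1"
    unfolding specialises_to_def by (intro exI[of _ q] exI[of _ p]) simp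
  then show ?thesis
    using specialises_to_mult[OF assms(1)] by (fastforce simp: divide_inverse)
qed

text \<open>When everything equals 1, the terms of \<open>tau_rest\<close> free of the parameters
  add up to 9 and the parameter \<open>a\<close> contributes -10, so the new value is again
  1.\<close>

lemma specialises_to_next:
  assumes "specialises_to x0 1" "specialises_to x1 1" "specialises_to x2 1" "specialises_to x3 1"
    "specialises_to x4 1" "specialises_to x5 1" "specialises_to x6 1"
  shows "specialises_to (- tau_rest X_a X_b X_nu x0 x1 x2 x3 x4 x5 x6 / tau_den x2 x3 x4) 1"
proof (rule specialises_to_divide)
  have "specialises_to (tau_rest X_a X_b X_nu x0 x1 x2 x3 x4 x5 x6)
    (tau_rest (- 10) 0 0 1 1 1 1 1 1 1)"
    unfolding tau_rest_def
    by (intro specialises_to_add specialises_to_mult specialises_to_power specialises_to_numeral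
        specialises_to_params assms)
  then show "specialises_to (- tau_rest X_a X_b X_nu x0 x1 x2 x3 x4 x5 x6) 1"
    using specialises_to_uminus by (fastforce simp: tau_rest_def)
  have "specialises_to (tau_den x2 x3 x4) (tau_den 1 1 1)"
    unfolding tau_den_def
    by (intro specialises_to_mult specialises_to_power assms)
  then show "specialises_to (tau_den x2 x3 x4) 1"
    by (simp add: tau_den_def)
qed

text \<open>The initial values are an argument because the backward half of the sequence is produced
  by the same iteration from the reversed window.\<close>

fun tau_forward :: "(nat \<Rightarrow> rat_funs) \<Rightarrow> nat \<Rightarrow> rat_funs" where
  "tau_forward I n = (if n < 7 then I n else
     - tau_rest X_a X_b X_nu (tau_forward I (n-7)) (tau_forward I (n-6)) (tau_forward I (n-5))
         (tau_forward I (n-4)) (tau_forward I (n-3)) (tau_forward I (n-2)) (tau_forward I (n-1))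
       / tau_den (tau_forward I (n-5)) (tau_forward I (n-4)) (tau_forward I (n-3)))"

declare tau_forward.simps [simp del]

lemma tau_forward_init: "n < 7 \<Longrightarrow> tau_forward I n = I n"
  by (simp add: tau_forward.simps)

lemma specialises_to_tau_forward:
  assumes "\<And>i. i < 7 \<Longrightarrow> specialises_to (I i) 1"
  shows "specialises_to (tau_forward I n) 1"
proof (induction n rule: less_induct)
  case (less n)
  show ?case
  proof (cases "n < 7")
    case True
    then show ?thesis using assms by (simp add: tau_forward_init)
  next
    case False
    then show ?thesis
      unfolding tau_forward.simps[of I n] if_not_P[OF False]
      by (intro specialises_to_next less) simp_all
  qed
qed

lemma recurrence_tau_forward:
  assumes "\<And>i. i < 7 \<Longrightarrow> specialises_to (I i) 1"
  shows "recurrence_lhs X_a X_b X_nu (\<lambda>i. tau_forward I (nat i)) (int k) = 0"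
proof -
  have nz: "tau_forward I n \<noteq> 0" for n
    using specialises_to_tau_forward[OF assms] by (rule specialises_to_one_nonzero)
  have idx: "nat (int k + numeral m) = k + numeral m" for m
    by (simp add: nat_add_distrib)
  have idx1: "nat (int k + 1) = k + 1"
    by (simp add: nat_add_distrib)
  have "tau_den (tau_forward I (k+2)) (tau_forward I (k+3)) (tau_forward I (k+4)) \<noteq> 0"
    using nz by (simp add: tau_den_def)
  then show ?thesis
    unfolding recurrence_lhs_eq idx idx1 nat_int
    by (subst tau_forward.simps[of I "k + 7"]) (simp add: numeral_eq_Suc)
qed

text \<open>Any solution without zeros qualifies, not only the generic one, so that the notion is
  stable under shifts and reflection.\<close>

definition good :: "(int \<Rightarrow> rat_funs) \<Rightarrow> bool" where
  "good \<tau> \<longleftrightarrow> (\<forall>n. \<tau> n \<noteq> 0) \<and> (\<forall>n. recurrence_lhs X_a X_b X_nu \<tau> n = 0)"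

lemma good_generic_exists:
  obtains \<tau> where "good \<tau>" "\<And>i. 0 \<le> i \<Longrightarrow> i \<le> 6 \<Longrightarrow> \<tau> i = to_fract (P_tau i)"
proof -
  define I J where "I = (\<lambda>i. to_fract (P_tau (int i)))" and "J = (\<lambda>i. to_fract (P_tau (6 - int i)))"
  have I: "specialises_to (I i) 1" if "i < 7" for i
    using that by (auto simp: I_def base_value_def ev_P_tau intro!: specialises_to_fract)
  have J: "specialises_to (J i) 1" if "i < 7" for i
    using that by (auto simp: J_def base_value_def ev_P_tau intro!: specialises_to_fract)
  define \<tau> where "\<tau> = (\<lambda>n. if n \<ge> 0 then tau_forward I (nat n) else tau_forward J (nat (6 - n)))"
  have pos: "\<tau> n = tau_forward I (nat n)" if "n \<ge> 0" for n
    using that by (simp add: \<tau>_def)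
  \<comment> \<open>On the overlap from 0 to 6 both branches return the same variable, so
    recurrences straddling 0 can be read entirely in the reversed half.\<close>
  have neg: "\<tau> n = tau_forward J (nat (6 - n))" if "n \<le> 6" for n
    using that by (auto simp: \<tau>_def tau_forward.simps I_def J_def)
  have nz: "\<tau> n \<noteq> 0" for n
    unfolding \<tau>_def
    using specialises_to_tau_forward[of I, OF I] specialises_to_tau_forward[of J, OF J]
    by (simp add: specialises_to_one_nonzero)
  have "recurrence_lhs X_a X_b X_nu \<tau> n = 0" for n
  proof (cases "n \<ge> 0")
    case True
    then have "recurrence_lhs X_a X_b X_nu \<tau> n =
      recurrence_lhs X_a X_b X_nu (\<lambda>i. tau_forward I (nat i)) n"
      by (intro recurrence_lhs_cong) (simp add: pos)
    then show ?thesis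
      using recurrence_tau_forward[of I "nat n", OF I] True by simp
  next
    case False
    have "recurrence_lhs X_a X_b X_nu \<tau> n =
      recurrence_lhs X_a X_b X_nu (\<lambda>i. \<tau> (6 - i)) (- n - 1)"
      by (simp add: recurrence_lhs_reflect)
    also have "\<dots> = recurrence_lhs X_a X_b X_nu (\<lambda>i. tau_forward J (nat i)) (- n - 1)"
      using False by (intro recurrence_lhs_cong) (simp add: neg)
    finally show ?thesis
      using recurrence_tau_forward[of J "nat (- n - 1)", OF J] False by simp
  qed
  moreover have "\<tau> i = to_fract (P_tau i)" if "0 \<le> i" "i \<le> 6" for i
    using that by (simp add: pos tau_forward_init I_def nat_less_iff)
  moreover have "good \<tau>"
    using nz calculation by (simp add: good_def)
  ultimately show thesis
    by (intro that)
qed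

section \<open>Singularity confinement\<close>

text \<open>In the recurrence at 0, the terms divisible by \<open>\<tau> 5 ^ 2\<close> sum to
  \<open>\<tau> 5 ^ 2 * conf_G\<close>. With \<open>conf_H\<close> below, the terms of exact degree
  one in \<open>\<tau> 5\<close> sum to
  \<open>- \<tau> 5 * \<tau> 3 ^ 2 * \<tau> 2 * conf_H\<close>.\<close>

definition conf_G :: "'a::comm_ring_1 \<Rightarrow> 'a \<Rightarrow> 'a \<Rightarrow> (int \<Rightarrow> 'a) \<Rightarrow> 'a" where
  "conf_G a b \<nu> \<tau> = 2 * \<tau> 6 * \<tau> 3^2 * \<tau> 2^3 + \<tau> 5^2 * \<tau> 2^4 + 2 * \<tau> 5 * \<tau> 4^2 * \<tau> 2^2 * \<tau> 1
     + \<tau> 4^4 * \<tau> 1^2 + \<tau> 4^3 * \<tau> 3^2 * \<tau> 0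
     + \<nu> * (\<tau> 5 * \<tau> 4 * \<tau> 3 * \<tau> 2^3 + \<tau> 4^3 * \<tau> 3 * \<tau> 2 * \<tau> 1) + b * \<tau> 4^2 * \<tau> 3^2 * \<tau> 2^2"

definition conf_H :: "'a::comm_ring_1 \<Rightarrow> 'a \<Rightarrow> (int \<Rightarrow> 'a) \<Rightarrow> 'a" where
  "conf_H a \<nu> \<tau> = - (\<tau> 6 * \<tau> 4^2 * \<tau> 1 + \<nu> * \<tau> 6 * \<tau> 4 * \<tau> 3 * \<tau> 2 + a * \<tau> 4^3 * \<tau> 3)"

text \<open>This and \<open>conf_F\<close> are given in closed form, without \<open>\<tau> 5\<close>
  in the denominator. That they are the quotients by powers of \<open>\<tau> 5\<close> is the
  content of \<open>conf_tau7\<close> and \<open>conf_tau8\<close>.\<close>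

definition conf_C :: "'a::field \<Rightarrow> 'a \<Rightarrow> 'a \<Rightarrow> (int \<Rightarrow> 'a) \<Rightarrow> 'a" where
  "conf_C a b \<nu> \<tau> = (conf_H a \<nu> \<tau> * \<tau> 3^2 * \<tau> 2 - \<tau> 5 * conf_G a b \<nu> \<tau>) / (\<tau> 3^3 * \<tau> 2^2)"

definition conf_F :: "'a::field \<Rightarrow> 'a \<Rightarrow> 'a \<Rightarrow> (int \<Rightarrow> 'a) \<Rightarrow> 'a" where
  "conf_F a b \<nu> \<tau> = \<tau> 6 * (conf_G a b \<nu> \<tau> - \<tau> 6 * \<tau> 3^2 * \<tau> 2^3) / (\<tau> 3^4 * \<tau> 2)"

context
  fixes a b \<nu> :: "'a::field" and \<tau> :: "int \<Rightarrow> 'a"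
  assumes nz: "\<And>n. \<tau> n \<noteq> 0" and rec: "\<And>n. recurrence_lhs a b \<nu> \<tau> n = 0"
begin

private abbreviation "C \<equiv> conf_C a b \<nu> \<tau>"
private abbreviation "F \<equiv> conf_F a b \<nu> \<tau>"
private abbreviation "G \<equiv> conf_G a b \<nu> \<tau>"
private abbreviation "H \<equiv> conf_H a \<nu> \<tau>"

lemma conf_C_eq: "C * \<tau> 3^3 * \<tau> 2^2 = H * \<tau> 3^2 * \<tau> 2 - \<tau> 5 * G"
  using nz by (simp add: conf_C_def)

lemma conf_F_eq: "F * \<tau> 3^4 * \<tau> 2 = \<tau> 6 * (G - \<tau> 6 * \<tau> 3^2 * \<tau> 2^3)"
  using nz by (simp add: conf_F_def)

lemma conf_tau7: "\<tau> 7 * \<tau> 4^2 = \<tau> 5 * C - \<tau> 6^2 * \<tau> 3"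
proof -
  have "(\<tau> 3^3 * \<tau> 2^2) * (\<tau> 7 * \<tau> 4^2) = (\<tau> 3^3 * \<tau> 2^2) * (\<tau> 5 * C - \<tau> 6^2 * \<tau> 3)"
    using rec[of 0] conf_C_eq unfolding recurrence_lhs_def conf_G_def conf_H_def
    by simp algebra
  then show ?thesis
    using nz by simp
qed

lemma conf_tau8:
  "\<tau> 8 * \<tau> 4^3 = \<tau> 5^2 * F - (C^2 + \<tau> 6^3 * \<tau> 2 + \<nu> * \<tau> 6 * \<tau> 4 * C + b * \<tau> 6^2 * \<tau> 4^2)"
proof -
  \<comment> \<open>The factor clears the part \<open>\<tau> 5 ^ 2 * \<tau> 3 ^ 2\<close> of the
    leading coefficient at 1 and the denominator of \<open>F\<close>.\<close>
  have "(\<tau> 5^2 * \<tau> 3^4 * \<tau> 2) * (\<tau> 8 * \<tau> 4^3) =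
    (\<tau> 5^2 * \<tau> 3^4 * \<tau> 2) * (\<tau> 5^2 * F - (C^2 + \<tau> 6^3 * \<tau> 2 + \<nu> * \<tau> 6 * \<tau> 4 * C + b * \<tau> 6^2 * \<tau> 4^2))"
    using rec[of 1] conf_C_eq conf_tau7 conf_F_eq unfolding recurrence_lhs_def conf_H_def
    by simp algebra
  then show ?thesis
    using nz by simp
qed

text \<open>By \<open>conf_tau7\<close>, the three terms without \<open>\<tau> 5\<close> form the
  square \<open>\<tau> 7 ^ 2 * (\<tau> 7 * \<tau> 4 ^ 2 + \<tau> 6 ^ 2 * \<tau> 3) ^ 2 = \<tau> 7 ^
  2 * \<tau> 5 ^ 2 * C ^ 2\<close>; \<open>conf_tau8\<close> then absorbs what is left into
  \<open>F\<close>, and \<open>\<tau> 5 ^ 3\<close> cancels.\<close>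

lemma conf_tau9:
  "\<tau> 9 * \<tau> 6^2 * \<tau> 4^2 = - (\<tau> 8^2 * \<tau> 5 * \<tau> 4^2 + \<tau> 8 * \<tau> 7 * \<tau> 4 * C + \<tau> 7^2 * \<tau> 5 * F
     + \<nu> * \<tau> 8 * \<tau> 7 * \<tau> 6 * \<tau> 4^2 + a * \<tau> 7 * \<tau> 6^3 * \<tau> 4)"
  (is "_ = ?r")
proof -
  have "\<tau> 5^3 * (\<tau> 9 * \<tau> 6^2 * \<tau> 4^2) = \<tau> 5^3 * ?r"
    using rec[of 2] conf_tau7 conf_tau8 unfolding recurrence_lhs_def
    by simp algebra
  then show ?thesis
    using nz by simp
qed

text \<open>The two terms without \<open>\<tau> 5\<close> combine through \<open>conf_tau7\<close>
  to \<open>\<tau> 8 ^ 2 * \<tau> 7 ^ 3 * \<tau> 5 * C\<close>. Together with the terms linear in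
  \<open>\<tau> 5\<close>, and after multiplication by \<open>\<tau> 4\<close>, they gain a second
  factor \<open>\<tau> 5\<close> by \<open>conf_tau9\<close>.\<close>

lemma conf_tau10:
  "\<tau> 10 * \<tau> 7^2 * \<tau> 6^3 * \<tau> 4 =
     - \<tau> 4 * (\<tau> 9^2 * \<tau> 6^4 + 2 * \<tau> 9 * \<tau> 8^2 * \<tau> 6^2 * \<tau> 5 + \<tau> 8^4 * \<tau> 5^2 + 2 * \<tau> 8^3 * \<tau> 7^2 * \<tau> 4
       + \<nu> * (\<tau> 9 * \<tau> 8 * \<tau> 7 * \<tau> 6^3 + \<tau> 8^3 * \<tau> 7 * \<tau> 6 * \<tau> 5) + b * \<tau> 8^2 * \<tau> 7^2 * \<tau> 6^2)
     + \<tau> 8 * \<tau> 7^2 * (\<tau> 8^2 * \<tau> 4^2 + \<tau> 7^2 * F)"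
  (is "_ = ?r")
proof -
  have "\<tau> 5^2 * (\<tau> 10 * \<tau> 7^2 * \<tau> 6^3 * \<tau> 4) = \<tau> 5^2 * ?r"
    using rec[of 3] conf_tau7 conf_tau9 unfolding recurrence_lhs_def
    by simp algebra
  then show ?thesis
    using nz by simp
qed

end

section \<open>Laurent polynomials along a solution\<close>

abbreviation evX :: "(int \<Rightarrow> rat_funs) \<Rightarrow> poly_ring \<Rightarrow> rat_funs" where
  "evX \<equiv> ev X_a X_b X_nu"

text \<open>\<open>Q\<close> speaks of functions of a parameter \<open>s\<close> rather than of
  values, so that it covers both regularity, with \<open>s\<close> a solution, and plain membership
  in a ring, with \<open>s\<close> trivial.\<close>

lemma eval_with_closed:
  assumes "\<And>s. is_hom (h s)"
    and add: "\<And>f g. Q f \<Longrightarrow> Q g \<Longrightarrow> Q (\<lambda>s. f s + g s)"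
    and mult: "\<And>f g. Q f \<Longrightarrow> Q g \<Longrightarrow> Q (\<lambda>s. f s * g s)"
    and h: "\<And>c. Q (\<lambda>s. h s c)" and x: "Q x"
  shows "Q (\<lambda>s. eval_with (h s) (x s) p)"
proof (induction p)
  case 0
  then show ?case using h[of 0] by (simp add: is_hom_zero assms(1))
next
  case (pCons c p)
  then show ?case by (simp add: eval_with_pCons assms(1) add mult h x)
qed

lemma ev_closed:
  fixes Q :: "('s \<Rightarrow> 'a::comm_ring_1) \<Rightarrow> bool"
  assumes add: "\<And>f g. Q f \<Longrightarrow> Q g \<Longrightarrow> Q (\<lambda>s. f s + g s)"
    and mult: "\<And>f g. Q f \<Longrightarrow> Q g \<Longrightarrow> Q (\<lambda>s. f s * g s)"
    and const: "\<And>n. Q (\<lambda>s. of_int n)" "Q (\<lambda>s. a)" "Q (\<lambda>s. b)" "Q (\<lambda>s. \<nu>)"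
    and \<tau>: "\<And>i. 0 \<le> i \<Longrightarrow> i \<le> 6 \<Longrightarrow> Q (\<lambda>s. \<tau> s i)"
  shows "Q (\<lambda>s. ev a b \<nu> (\<tau> s) p)"
  unfolding ev_def
  by (intro eval_with_closed[where Q = Q] is_hom_eval_with is_hom_of_int_fun add mult const \<tau>) simp_all

lemma good_evX_to_fract_exists:
  obtains \<tau> where "good \<tau>" "evX \<tau> = to_fract"
proof (rule good_generic_exists)
  fix \<tau> assume "good \<tau>" and "\<And>i. 0 \<le> i \<Longrightarrow> i \<le> 6 \<Longrightarrow> \<tau> i = to_fract (P_tau i)"
  then show thesis
    using that ev_generic by blast
qed

definition P_mid :: poly_ring where
  "P_mid = P_tau 2 * P_tau 3 * P_tau 4"

lemma ev_P_mid: "ev a b \<nu> \<tau> P_mid = \<tau> 2 * \<tau> 3 * \<tau> 4"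
  by (simp add: P_mid_def ev_simps ev_P_tau)

text \<open>Laurent polynomials with denominators in the middle of the window. One \<open>p\<close>
  and one \<open>m\<close> serve all good solutions, which is what allows a formula to be applied to
  a shifted or reflected solution.\<close>

definition regular :: "((int \<Rightarrow> rat_funs) \<Rightarrow> rat_funs) \<Rightarrow> bool" where
  "regular f \<longleftrightarrow> (\<exists>p m. \<forall>\<tau>. good \<tau> \<longrightarrow> f \<tau> * (\<tau> 2 * \<tau> 3 * \<tau> 4) ^ m = evX \<tau> p)"

lemma regularI: "(\<And>\<tau>. good \<tau> \<Longrightarrow> f \<tau> * (\<tau> 2 * \<tau> 3 * \<tau> 4) ^ m = evX \<tau> p) \<Longrightarrow> regular f"
  unfolding regular_def by blast

lemma regular_cong: "regular f \<Longrightarrow> (\<And>\<tau>. good \<tau> \<Longrightarrow> g \<tau> = f \<tau>) \<Longrightarrow> regular g"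
  unfolding regular_def by simp

lemma regular_ev: "regular (\<lambda>\<tau>. evX \<tau> p)"
  by (rule regularI[of _ 0 p]) simp

lemma regular_tau: "0 \<le> i \<Longrightarrow> i \<le> 6 \<Longrightarrow> regular (\<lambda>\<tau>. \<tau> i)"
  using regular_ev[of "P_tau i"] by (simp add: ev_P_tau)

lemma regular_params: "regular (\<lambda>\<tau>. X_a)" "regular (\<lambda>\<tau>. X_b)" "regular (\<lambda>\<tau>. X_nu)"
  using regular_ev[of P_a] regular_ev[of P_b] regular_ev[of P_nu]
  by (simp_all add: ev_P_a ev_P_b ev_P_nu)

lemma regular_of_int: "regular (\<lambda>\<tau>. of_int n)"
  using regular_ev[of "of_int n"] by (simp add: is_hom_of_int[OF is_hom_ev])

lemma regular_numeral: "regular (\<lambda>\<tau>. numeral n)"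
  using regular_of_int[of "numeral n"] by simp

lemma regular_add:
  assumes "regular f" "regular g"
  shows "regular (\<lambda>\<tau>. f \<tau> + g \<tau>)"
proof -
  obtain p m q k where *: "\<And>\<tau>. good \<tau> \<Longrightarrow> f \<tau> * (\<tau> 2 * \<tau> 3 * \<tau> 4) ^ m = evX \<tau> p"
    "\<And>\<tau>. good \<tau> \<Longrightarrow> g \<tau> * (\<tau> 2 * \<tau> 3 * \<tau> 4) ^ k = evX \<tau> q"
    using assms unfolding regular_def by blast
  show ?thesis
    by (rule regularI[of _ "m + k" "p * P_mid ^ k + q * P_mid ^ m"])
       (simp add: ev_simps ev_P_mid power_add algebra_simps flip: *)
qed

lemma regular_mult:
  assumes "regular f" "regular g"
  shows "regular (\<lambda>\<tau>. f \<tau> * g \<tau>)"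
proof -
  obtain p m q k where *: "\<And>\<tau>. good \<tau> \<Longrightarrow> f \<tau> * (\<tau> 2 * \<tau> 3 * \<tau> 4) ^ m = evX \<tau> p"
    "\<And>\<tau>. good \<tau> \<Longrightarrow> g \<tau> * (\<tau> 2 * \<tau> 3 * \<tau> 4) ^ k = evX \<tau> q"
    using assms unfolding regular_def by blast
  show ?thesis
    by (rule regularI[of _ "m + k" "p * q"])
       (simp add: ev_simps power_add algebra_simps flip: *)
qed

lemma regular_uminus: "regular f \<Longrightarrow> regular (\<lambda>\<tau>. - f \<tau>)"
  using regular_mult[OF regular_of_int[of "- 1"], of f] by simp

lemma regular_diff: "regular f \<Longrightarrow> regular g \<Longrightarrow> regular (\<lambda>\<tau>. f \<tau> - g \<tau>)"
  using regular_add[of f "\<lambda>\<tau>. - g \<tau>"] by (simp add: regular_uminus)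

lemma regular_power: "regular f \<Longrightarrow> regular (\<lambda>\<tau>. f \<tau> ^ n)"
  using regular_of_int[of 1] by (induction n) (simp_all add: regular_mult)

lemmas regular_intros = regular_add regular_diff regular_uminus regular_mult regular_power
  regular_numeral regular_params regular_tau

lemma regular_cancel:
  assumes "regular (\<lambda>\<tau>. f \<tau> * (\<tau> 2 ^ i * \<tau> 3 ^ j * \<tau> 4 ^ k))"
  shows "regular f"
proof -
  \<comment> \<open>The second factor completes all three exponents to
    \<open>i + j + k\<close>.\<close>
  have "regular (\<lambda>\<tau>. f \<tau> * (\<tau> 2 ^ i * \<tau> 3 ^ j * \<tau> 4 ^ k) *
      (\<tau> 2 ^ (j + k) * \<tau> 3 ^ (i + k) * \<tau> 4 ^ (i + j)))"
    by (intro regular_mult[OF assms] regular_intros) simp_all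
  then have "regular (\<lambda>\<tau>. f \<tau> * (\<tau> 2 * \<tau> 3 * \<tau> 4) ^ (i + j + k))"
    by (rule regular_cong) (simp add: power_mult_distrib power_add mult_ac)
  then obtain p m where "\<And>\<tau>. good \<tau> \<Longrightarrow>
      f \<tau> * (\<tau> 2 * \<tau> 3 * \<tau> 4) ^ (i + j + k) * (\<tau> 2 * \<tau> 3 * \<tau> 4) ^ m = evX \<tau> p"
    unfolding regular_def by metis
  then show ?thesis
    by (intro regularI[of _ "i + j + k + m" p]) (simp add: power_add mult.assoc)
qed

section \<open>Coprimality to \<open>\<tau> 5\<close> and removal of denominators\<close>

definition prime_to_tau5 :: "((int \<Rightarrow> rat_funs) \<Rightarrow> rat_funs) \<Rightarrow> bool" where
  "prime_to_tau5 f \<longleftrightarrow> (\<exists>p m. \<not> P_tau 5 dvd p \<and>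
     (\<forall>\<tau>. good \<tau> \<longrightarrow> f \<tau> * (\<tau> 2 * \<tau> 3 * \<tau> 4) ^ m = evX \<tau> p))"

lemma prime_to_tau5I:
  "\<not> P_tau 5 dvd p \<Longrightarrow> (\<And>\<tau>. good \<tau> \<Longrightarrow> f \<tau> * (\<tau> 2 * \<tau> 3 * \<tau> 4) ^ m = evX \<tau> p) \<Longrightarrow>
    prime_to_tau5 f"
  unfolding prime_to_tau5_def by blast

lemma prime_to_tau5_cong:
  "prime_to_tau5 f \<Longrightarrow> (\<And>\<tau>. good \<tau> \<Longrightarrow> g \<tau> = f \<tau>) \<Longrightarrow> prime_to_tau5 g"
  unfolding prime_to_tau5_def by simp

lemma not_P_tau5_dvd_mult: "\<not> P_tau 5 dvd p \<Longrightarrow> \<not> P_tau 5 dvd q \<Longrightarrow> \<not> P_tau 5 dvd p * q"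
  using prime_elem_dvd_mult_iff[OF prime_P_tau5] by blast

lemma not_P_tau5_dvd_P_mid: "\<not> P_tau 5 dvd P_mid ^ n"
  by (rule not_P_tau5_dvd[of 0 0 0 "\<lambda>i. if i = 5 then 0 else 1 :: int"])
     (simp_all add: ev_simps ev_P_mid)

lemma prime_to_tau5_mult:
  assumes "prime_to_tau5 f" "prime_to_tau5 g"
  shows "prime_to_tau5 (\<lambda>\<tau>. f \<tau> * g \<tau>)"
proof -
  obtain p m where p: "\<not> P_tau 5 dvd p"
    "\<And>\<tau>. good \<tau> \<Longrightarrow> f \<tau> * (\<tau> 2 * \<tau> 3 * \<tau> 4) ^ m = evX \<tau> p"
    using assms(1) unfolding prime_to_tau5_def by blast
  obtain q k where q: "\<not> P_tau 5 dvd q"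
    "\<And>\<tau>. good \<tau> \<Longrightarrow> g \<tau> * (\<tau> 2 * \<tau> 3 * \<tau> 4) ^ k = evX \<tau> q"
    using assms(2) unfolding prime_to_tau5_def by blast
  show ?thesis
    by (rule prime_to_tau5I[of "p * q" _ "m + k"], rule not_P_tau5_dvd_mult[OF p(1) q(1)])
       (simp add: ev_simps power_add algebra_simps flip: p(2) q(2))
qed

lemma prime_to_tau5_power: "prime_to_tau5 f \<Longrightarrow> prime_to_tau5 (\<lambda>\<tau>. f \<tau> ^ n)"
proof (induction n)
  case 0
  show ?case
    by (rule prime_to_tau5I[of "P_mid ^ 0" _ 0], rule not_P_tau5_dvd_P_mid) (simp add: ev_simps)
qed (simp add: prime_to_tau5_mult)

lemma prime_to_tau5_add:
  assumes "prime_to_tau5 f" "regular g"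
  shows "prime_to_tau5 (\<lambda>\<tau>. f \<tau> + \<tau> 5 * g \<tau>)"
proof -
  obtain p m where p: "\<not> P_tau 5 dvd p"
    "\<And>\<tau>. good \<tau> \<Longrightarrow> f \<tau> * (\<tau> 2 * \<tau> 3 * \<tau> 4) ^ m = evX \<tau> p"
    using assms(1) unfolding prime_to_tau5_def by blast
  obtain q k where q: "\<And>\<tau>. good \<tau> \<Longrightarrow> g \<tau> * (\<tau> 2 * \<tau> 3 * \<tau> 4) ^ k = evX \<tau> q"
    using assms(2) unfolding regular_def by blast
  have "\<not> P_tau 5 dvd p * P_mid ^ k + P_tau 5 * (q * P_mid ^ m)"
    using not_P_tau5_dvd_mult[OF p(1) not_P_tau5_dvd_P_mid] by (simp add: dvd_add_left_iff)
  then show ?thesis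
    by (rule prime_to_tau5I[of _ _ "m + k"])
       (simp add: ev_simps ev_P_mid ev_P_tau power_add algebra_simps flip: p(2) q)
qed

text \<open>At the generic solution \<open>evX\<close> is the embedding \<open>to_fract\<close>, so
  identities between values become identities of polynomials, where divisibility can be
  tested.\<close>

lemma prime_to_tau5_factor:
  assumes "regular f" "regular g" "prime_to_tau5 (\<lambda>\<tau>. f \<tau> * g \<tau>)"
  shows "prime_to_tau5 f"
proof -
  obtain p m q k where *: "\<And>\<tau>. good \<tau> \<Longrightarrow> f \<tau> * (\<tau> 2 * \<tau> 3 * \<tau> 4) ^ m = evX \<tau> p"
    "\<And>\<tau>. good \<tau> \<Longrightarrow> g \<tau> * (\<tau> 2 * \<tau> 3 * \<tau> 4) ^ k = evX \<tau> q"
    using assms(1,2) unfolding regular_def by blast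
  obtain d l where d: "\<not> P_tau 5 dvd d"
    "\<And>\<tau>. good \<tau> \<Longrightarrow> f \<tau> * g \<tau> * (\<tau> 2 * \<tau> 3 * \<tau> 4) ^ l = evX \<tau> d"
    using assms(3) unfolding prime_to_tau5_def by blast
  obtain \<tau> where \<tau>: "good \<tau>" "evX \<tau> = to_fract"
    by (rule good_evX_to_fract_exists)
  let ?u = "\<tau> 2 * \<tau> 3 * \<tau> 4"
  have "evX \<tau> (p * (q * P_mid ^ l)) = (f \<tau> * ?u ^ m) * ((g \<tau> * ?u ^ k) * ?u ^ l)"
    by (simp only: ev_simps ev_P_mid *[OF \<tau>(1)])
  also have "\<dots> = (f \<tau> * g \<tau> * ?u ^ l) * ?u ^ (m + k)"
    by (simp only: power_add mult_ac)
  also have "\<dots> = evX \<tau> (d * P_mid ^ (m + k))"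
    by (simp only: ev_simps ev_P_mid d(2)[OF \<tau>(1)])
  finally have "evX \<tau> (p * (q * P_mid ^ l)) = evX \<tau> (d * P_mid ^ (m + k))" .
  then have eq: "p * (q * P_mid ^ l) = d * P_mid ^ (m + k)"
    by (simp only: \<tau>(2) to_fract_eq_iff)
  have "\<not> P_tau 5 dvd p * (q * P_mid ^ l)"
    unfolding eq by (rule not_P_tau5_dvd_mult[OF d(1) not_P_tau5_dvd_P_mid])
  then have "\<not> P_tau 5 dvd p"
    using dvd_mult2 by blast
  then show ?thesis
    using * by (blast intro: prime_to_tau5I)
qed

text \<open>In a mere integral domain the factors \<open>P\<close> are split off \<open>p\<close>
  one at a time.\<close>

lemma prime_elem_power_dvd_cancel:
  fixes P :: "'a::idom"
  assumes P: "prime_elem P" and "P ^ n dvd p * q" "\<not> P dvd q"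
  shows "P ^ n dvd p"
  using assms(2)
proof (induction n arbitrary: p)
  case (Suc n)
  have "P dvd p * q"
    using Suc.prems by (metis dvd_mult_left power_Suc)
  then have "P dvd p"
    using assms(3) prime_elem_dvd_mult_iff[OF P] by blast
  then obtain r where r: "p = P * r"
    by (rule dvdE)
  have "P \<noteq> 0"
    using P by auto
  then have "P ^ n dvd r * q"
    using Suc.prems(1) by (simp add: r mult.assoc)
  then have "P ^ n dvd r"
    by (rule Suc.IH)
  then show ?case
    by (simp add: r mult_dvd_mono)
qed simp

text \<open>Comparing both representations of \<open>f\<close> at the generic solution shows that
  \<open>P_tau 5 ^ n\<close> divides the numerator \<open>p\<close> of the first one times a
  polynomial prime to \<open>P_tau 5\<close>, hence \<open>p\<close> itself.\<close>

lemma regular_coprime_denominators: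
  assumes "regular (\<lambda>\<tau>. f \<tau> * \<tau> 5 ^ n)" "regular (\<lambda>\<tau>. f \<tau> * g \<tau>)" "prime_to_tau5 g"
  shows "regular f"
proof -
  obtain p m q k where *: "\<And>\<tau>. good \<tau> \<Longrightarrow> f \<tau> * \<tau> 5 ^ n * (\<tau> 2 * \<tau> 3 * \<tau> 4) ^ m = evX \<tau> p"
    "\<And>\<tau>. good \<tau> \<Longrightarrow> f \<tau> * g \<tau> * (\<tau> 2 * \<tau> 3 * \<tau> 4) ^ k = evX \<tau> q"
    using assms(1,2) unfolding regular_def by blast
  obtain d l where d: "\<not> P_tau 5 dvd d"
    "\<And>\<tau>. good \<tau> \<Longrightarrow> g \<tau> * (\<tau> 2 * \<tau> 3 * \<tau> 4) ^ l = evX \<tau> d"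
    using assms(3) unfolding prime_to_tau5_def by blast
  obtain \<tau> where \<tau>: "good \<tau>" "evX \<tau> = to_fract"
    by (rule good_evX_to_fract_exists)
  let ?u = "\<tau> 2 * \<tau> 3 * \<tau> 4"
  have ev5: "evX \<tau> (P_tau 5) = \<tau> 5"
    by (simp add: ev_P_tau)
  have "evX \<tau> (p * (d * P_mid ^ k)) = (f \<tau> * \<tau> 5 ^ n * ?u ^ m) * ((g \<tau> * ?u ^ l) * ?u ^ k)"
    by (simp only: ev_simps ev_P_mid *(1)[OF \<tau>(1)] d(2)[OF \<tau>(1)])
  also have "\<dots> = \<tau> 5 ^ n * ((f \<tau> * g \<tau> * ?u ^ k) * ?u ^ (m + l))"
    by (simp only: power_add mult_ac)
  also have "\<dots> = evX \<tau> (P_tau 5 ^ n * (q * P_mid ^ (m + l)))"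
    by (simp only: ev_simps ev_P_mid ev5 *(2)[OF \<tau>(1)])
  finally have "evX \<tau> (p * (d * P_mid ^ k)) = evX \<tau> (P_tau 5 ^ n * (q * P_mid ^ (m + l)))" .
  then have "p * (d * P_mid ^ k) = P_tau 5 ^ n * (q * P_mid ^ (m + l))"
    by (simp only: \<tau>(2) to_fract_eq_iff)
  then have "P_tau 5 ^ n dvd p * (d * P_mid ^ k)"
    by (metis dvd_triv_left)
  then have "P_tau 5 ^ n dvd p"
    by (rule prime_elem_power_dvd_cancel[OF prime_P_tau5]) (rule not_P_tau5_dvd_mult[OF d(1) not_P_tau5_dvd_P_mid])
  then obtain r where r: "p = P_tau 5 ^ n * r"
    by (rule dvdE)
  \<comment> \<open>The divisibility is a polynomial identity, so it carries over from the generic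
    to every good solution.\<close>
  show ?thesis
  proof (rule regularI[of _ m r])
    fix \<tau> assume "good \<tau>"
    then have "\<tau> 5 ^ n * (f \<tau> * (\<tau> 2 * \<tau> 3 * \<tau> 4) ^ m) = \<tau> 5 ^ n * evX \<tau> r" "\<tau> 5 \<noteq> 0"
      using *(1)[of \<tau>] by (simp_all add: r ev_simps ev_P_tau mult_ac good_def)
    then show "f \<tau> * (\<tau> 2 * \<tau> 3 * \<tau> 4) ^ m = evX \<tau> r"
      by simp
  qed
qed

section \<open>Shifts and reflections of solutions\<close>

lemma good_shift: "good \<tau> \<Longrightarrow> good (\<lambda>i. \<tau> (i + j))"
  by (simp add: good_def recurrence_lhs_shift)

lemma good_reflect: "good \<tau> \<Longrightarrow> good (\<lambda>i. \<tau> (6 - i))"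
  by (simp add: good_def recurrence_lhs_reflect)

text \<open>Substituting the shifted window into the numerator keeps it regular; the only new
  denominators are the three middle entries of that window.\<close>

lemma regular_shift:
  assumes "regular f" and win: "\<And>i. 0 \<le> i \<Longrightarrow> i \<le> 6 \<Longrightarrow> regular (\<lambda>\<tau>. \<tau> (i + j))"
  obtains m where
    "regular (\<lambda>\<tau>. f (\<lambda>i. \<tau> (i + j)) * (\<tau> (2 + j) * \<tau> (3 + j) * \<tau> (4 + j)) ^ m)"
proof -
  obtain p m where p: "\<And>\<tau>. good \<tau> \<Longrightarrow> f \<tau> * (\<tau> 2 * \<tau> 3 * \<tau> 4) ^ m = evX \<tau> p"
    using assms(1) unfolding regular_def by blast
  have "regular (\<lambda>\<tau>. evX (\<lambda>i. \<tau> (i + j)) p)"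
    by (rule ev_closed[where Q = regular]) (auto intro: regular_intros regular_of_int win)
  then have "regular (\<lambda>\<tau>. f (\<lambda>i. \<tau> (i + j)) * (\<tau> (2 + j) * \<tau> (3 + j) * \<tau> (4 + j)) ^ m)"
    by (rule regular_cong) (use p[OF good_shift] in simp)
  then show thesis
    by (rule that)
qed

text \<open>The middle of the window starting at 1 is \<open>\<tau> 3\<close>,
  \<open>\<tau> 4\<close>, \<open>\<tau> 5\<close>, of which the first two are already
  invertible.\<close>

lemma regular_tau_shift_one:
  assumes "regular (\<lambda>\<tau>. \<tau> n)" "regular (\<lambda>\<tau>. \<tau> 7)"
  obtains m where "regular (\<lambda>\<tau>. \<tau> (n + 1) * \<tau> 5 ^ m)"
proof -
  have "regular (\<lambda>\<tau>. \<tau> (i + 1))" if "0 \<le> i" "i \<le> 6" for i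
    using that assms(2) by (cases "i = 6") (auto intro: regular_tau)
  then obtain m where "regular (\<lambda>\<tau>. \<tau> (n + 1) * (\<tau> (2 + 1) * \<tau> (3 + 1) * \<tau> (4 + 1)) ^ m)"
    using regular_shift[OF assms(1), of 1] by blast
  then have "regular (\<lambda>\<tau>. \<tau> (n + 1) * \<tau> 5 ^ m * (\<tau> 2 ^ 0 * \<tau> 3 ^ m * \<tau> 4 ^ m))"
    by (rule regular_cong) (simp add: power_mult_distrib mult_ac)
  then have "regular (\<lambda>\<tau>. \<tau> (n + 1) * \<tau> 5 ^ m)"
    by (rule regular_cancel)
  then show thesis
    by (rule that)
qed

section \<open>The Laurent property\<close>

abbreviation "tau_C \<equiv> conf_C X_a X_b X_nu"
abbreviation "tau_F \<equiv> conf_F X_a X_b X_nu"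
abbreviation "tau_G \<equiv> conf_G X_a X_b X_nu"
abbreviation "tau_H \<equiv> conf_H X_a X_nu"

lemma good_nonzero: "good \<tau> \<Longrightarrow> \<tau> n \<noteq> 0"
  and good_recurrence: "good \<tau> \<Longrightarrow> recurrence_lhs X_a X_b X_nu \<tau> n = 0"
  by (simp_all add: good_def)

lemma
  assumes "good \<tau>"
  shows good_conf_C: "tau_C \<tau> * \<tau> 3^3 * \<tau> 2^2 = tau_H \<tau> * \<tau> 3^2 * \<tau> 2 - \<tau> 5 * tau_G \<tau>"
    and good_conf_F: "tau_F \<tau> * \<tau> 3^4 * \<tau> 2 = \<tau> 6 * (tau_G \<tau> - \<tau> 6 * \<tau> 3^2 * \<tau> 2^3)"
    and good_conf_tau7: "\<tau> 7 * \<tau> 4^2 = \<tau> 5 * tau_C \<tau> - \<tau> 6^2 * \<tau> 3"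
    and good_conf_tau8: "\<tau> 8 * \<tau> 4^3 = \<tau> 5^2 * tau_F \<tau> -
      (tau_C \<tau>^2 + \<tau> 6^3 * \<tau> 2 + X_nu * \<tau> 6 * \<tau> 4 * tau_C \<tau> + X_b * \<tau> 6^2 * \<tau> 4^2)"
  by (rule conf_C_eq conf_F_eq conf_tau7 conf_tau8;
      rule good_nonzero[OF assms] good_recurrence[OF assms])+

lemma regular_tau_G: "regular tau_G"
  unfolding conf_G_def[abs_def] by (intro regular_intros) simp_all

lemma regular_tau_H: "regular tau_H"
  unfolding conf_H_def[abs_def] by (intro regular_intros) simp_all

lemma regular_tau_C: "regular tau_C"
proof -
  have "regular (\<lambda>\<tau>. tau_H \<tau> * \<tau> 3^2 * \<tau> 2 - \<tau> 5 * tau_G \<tau>)"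
    by (intro regular_intros regular_tau_G regular_tau_H) simp_all
  then have "regular (\<lambda>\<tau>. tau_C \<tau> * \<tau> 3^3 * \<tau> 2^2)"
    by (rule regular_cong) (rule good_conf_C)
  then have "regular (\<lambda>\<tau>. tau_C \<tau> * (\<tau> 2 ^ 2 * \<tau> 3 ^ 3 * \<tau> 4 ^ 0))"
    by (rule regular_cong) (simp add: mult_ac)
  then show ?thesis by (rule regular_cancel)
qed

lemma regular_tau_F: "regular tau_F"
proof -
  have "regular (\<lambda>\<tau>. \<tau> 6 * (tau_G \<tau> - \<tau> 6 * \<tau> 3^2 * \<tau> 2^3))"
    by (intro regular_intros regular_tau_G) simp_all
  then have "regular (\<lambda>\<tau>. tau_F \<tau> * \<tau> 3^4 * \<tau> 2)"
    by (rule regular_cong) (rule good_conf_F)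
  then have "regular (\<lambda>\<tau>. tau_F \<tau> * (\<tau> 2 ^ 1 * \<tau> 3 ^ 4 * \<tau> 4 ^ 0))"
    by (rule regular_cong) (simp add: mult_ac)
  then show ?thesis by (rule regular_cancel)
qed

lemma regular_tau7: "regular (\<lambda>\<tau>. \<tau> 7)"
proof -
  have "regular (\<lambda>\<tau>. \<tau> 5 * tau_C \<tau> - \<tau> 6^2 * \<tau> 3)"
    by (intro regular_intros regular_tau_C) simp_all
  then have "regular (\<lambda>\<tau>. \<tau> 7 * (\<tau> 2 ^ 0 * \<tau> 3 ^ 0 * \<tau> 4 ^ 2))"
    by (rule regular_cong) (simp add: good_conf_tau7)
  then show ?thesis by (rule regular_cancel)
qed

lemma regular_tau8: "regular (\<lambda>\<tau>. \<tau> 8)"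
proof -
  have "regular (\<lambda>\<tau>. \<tau> 5^2 * tau_F \<tau> -
      (tau_C \<tau>^2 + \<tau> 6^3 * \<tau> 2 + X_nu * \<tau> 6 * \<tau> 4 * tau_C \<tau> + X_b * \<tau> 6^2 * \<tau> 4^2))"
    by (intro regular_intros regular_tau_C regular_tau_F) simp_all
  then have "regular (\<lambda>\<tau>. \<tau> 8 * (\<tau> 2 ^ 0 * \<tau> 3 ^ 0 * \<tau> 4 ^ 3))"
    by (rule regular_cong) (simp add: good_conf_tau8)
  then show ?thesis by (rule regular_cancel)
qed

lemma prime_to_tau5_ev: "\<not> P_tau 5 dvd p \<Longrightarrow> prime_to_tau5 (\<lambda>\<tau>. evX \<tau> p)"
  by (rule prime_to_tau5I[of p _ 0]) simp_all

lemma prime_to_tau5_tau6: "prime_to_tau5 (\<lambda>\<tau>. \<tau> 6)"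
proof -
  have "\<not> P_tau 5 dvd P_tau 6"
    by (rule not_P_tau5_dvd[of 0 0 0 "\<lambda>i. if i = 5 then 0 else 1 :: int"]) (simp_all add: ev_P_tau)
  then show ?thesis
    using prime_to_tau5_ev[of "P_tau 6"] by (simp add: ev_P_tau)
qed

text \<open>Modulo \<open>\<tau> 5\<close>, the product \<open>\<tau> 7 * \<tau> 4 ^ 2\<close>
  reduces to the monomial \<open>- (\<tau> 6 ^ 2 * \<tau> 3)\<close>.\<close>

lemma prime_to_tau5_tau7: "prime_to_tau5 (\<lambda>\<tau>. \<tau> 7)"
proof (rule prime_to_tau5_factor)
  let ?p = "- (P_tau 6^2 * P_tau 3)"
  have "\<not> P_tau 5 dvd ?p"
    by (rule not_P_tau5_dvd[of 0 0 0 "\<lambda>i. if i = 5 then 0 else 1 :: int"])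
       (simp_all add: ev_simps ev_P_tau)
  then have "prime_to_tau5 (\<lambda>\<tau>. evX \<tau> ?p + \<tau> 5 * tau_C \<tau>)"
    by (intro prime_to_tau5_add prime_to_tau5_ev regular_tau_C)
  then show "prime_to_tau5 (\<lambda>\<tau>. \<tau> 7 * \<tau> 4^2)"
    by (rule prime_to_tau5_cong) (simp add: ev_simps ev_P_tau good_conf_tau7)
  show "regular (\<lambda>\<tau>. \<tau> 7)" "regular (\<lambda>\<tau>. \<tau> 4^2)"
    by (intro regular_intros regular_tau7; simp)+
qed

text \<open>Modulo \<open>\<tau>\<^sub>5\<close> the function \<open>C \<tau>\<^sub>3 \<tau>\<^sub>2\<close> reduces to the polynomial \<open>H\<close>, so
  \<open>\<tau>\<^sub>8\<close> reduces, up to powers of \<open>\<tau>\<^sub>2, \<tau>\<^sub>3, \<tau>\<^sub>4\<close>, to the polynomial below.\<close>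

lemma prime_to_tau5_tau8: "prime_to_tau5 (\<lambda>\<tau>. \<tau> 8)"
proof (rule prime_to_tau5_factor)
  let ?H = "- (P_tau 6 * P_tau 4^2 * P_tau 1 + P_nu * P_tau 6 * P_tau 4 * P_tau 3 * P_tau 2
     + P_a * P_tau 4^3 * P_tau 3)"
  let ?p = "- (?H^2 + P_tau 6^3 * P_tau 3^2 * P_tau 2^3 + P_nu * P_tau 6 * P_tau 4 * P_tau 3 * P_tau 2 * ?H
     + P_b * P_tau 6^2 * P_tau 4^2 * P_tau 3^2 * P_tau 2^2)"
  \<comment> \<open>\<open>J\<close> measures the error, divided by \<open>\<tau> 5\<close>, of
    replacing \<open>tau_C \<tau> * \<tau> 3 * \<tau> 2\<close> by
    \<open>tau_H \<tau>\<close>.\<close>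
  define J where "J = (\<lambda>\<tau>. tau_G \<tau> / (\<tau> 3^2 * \<tau> 2))"
  have J: "J \<tau> * (\<tau> 3^2 * \<tau> 2) = tau_G \<tau>" if "good \<tau>" for \<tau>
    using good_nonzero[OF that] by (simp add: J_def)
  have "regular (\<lambda>\<tau>. J \<tau> * (\<tau> 2 ^ 1 * \<tau> 3 ^ 2 * \<tau> 4 ^ 0))"
    by (rule regular_cong[OF regular_tau_G]) (simp add: mult_ac flip: J)
  then have reg_J: "regular J"
    by (rule regular_cancel)
  have H: "tau_C \<tau> * \<tau> 3 * \<tau> 2 = tau_H \<tau> - \<tau> 5 * J \<tau>" if "good \<tau>" for \<tau>
  proof -
    have "\<tau> 3^2 * \<tau> 2 * (tau_C \<tau> * \<tau> 3 * \<tau> 2) = \<tau> 3^2 * \<tau> 2 * (tau_H \<tau> - \<tau> 5 * J \<tau>)"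
      using good_conf_C[OF that] J[OF that] by algebra
    then show ?thesis
      using good_nonzero[OF that] by simp
  qed
  have ev_H: "evX \<tau> ?H = tau_H \<tau>" for \<tau>
    by (simp add: conf_H_def ev_simps ev_P_tau ev_P_a ev_P_nu)
  have "\<not> P_tau 5 dvd ?p"
    \<comment> \<open>With \<open>\<tau> 1\<close> and all parameters 0, \<open>?H\<close> vanishes
      and \<open>?p\<close> takes the value -1.\<close>
    by (rule not_P_tau5_dvd[of 0 0 0 "\<lambda>i. if i = 1 \<or> i = 5 then 0 else 1 :: int"])
       (simp_all add: ev_simps ev_P_tau ev_P_a ev_P_b ev_P_nu)
  then have "prime_to_tau5 (\<lambda>\<tau>. evX \<tau> ?p + \<tau> 5 * (\<tau> 5 * tau_F \<tau> * \<tau> 3^2 * \<tau> 2^2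
      + 2 * tau_H \<tau> * J \<tau> - \<tau> 5 * J \<tau>^2 + X_nu * \<tau> 6 * \<tau> 4 * \<tau> 3 * \<tau> 2 * J \<tau>))"
    by (intro prime_to_tau5_add prime_to_tau5_ev regular_intros regular_tau_F regular_tau_H reg_J)
       simp_all
  then show "prime_to_tau5 (\<lambda>\<tau>. \<tau> 8 * (\<tau> 4^3 * \<tau> 3^2 * \<tau> 2^2))"
  proof (rule prime_to_tau5_cong)
    fix \<tau> assume \<tau>: "good \<tau>"
    have "evX \<tau> ?p = - (tau_H \<tau>^2 + \<tau> 6^3 * \<tau> 3^2 * \<tau> 2^3
        + X_nu * \<tau> 6 * \<tau> 4 * \<tau> 3 * \<tau> 2 * tau_H \<tau> + X_b * \<tau> 6^2 * \<tau> 4^2 * \<tau> 3^2 * \<tau> 2^2)"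
      unfolding ev_H[symmetric] by (simp add: ev_simps ev_P_tau ev_P_b ev_P_nu)
    then show "\<tau> 8 * (\<tau> 4^3 * \<tau> 3^2 * \<tau> 2^2) = evX \<tau> ?p + \<tau> 5 * (\<tau> 5 * tau_F \<tau> * \<tau> 3^2 * \<tau> 2^2
      + 2 * tau_H \<tau> * J \<tau> - \<tau> 5 * J \<tau>^2 + X_nu * \<tau> 6 * \<tau> 4 * \<tau> 3 * \<tau> 2 * J \<tau>)"
      using good_conf_tau8[OF \<tau>] H[OF \<tau>] by algebra
  qed
  show "regular (\<lambda>\<tau>. \<tau> 8)" "regular (\<lambda>\<tau>. \<tau> 4^3 * \<tau> 3^2 * \<tau> 2^2)"
    by (intro regular_intros regular_tau8; simp)+
qed

text \<open>Confinement leaves \<open>\<tau> 6 ^ 2\<close> as denominator, the window starting at 1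
  leaves a power of \<open>\<tau> 5\<close>, and these are coprime.\<close>

lemma regular_tau9: "regular (\<lambda>\<tau>. \<tau> 9)"
proof -
  have "regular (\<lambda>\<tau>. - (\<tau> 8^2 * \<tau> 5 * \<tau> 4^2 + \<tau> 8 * \<tau> 7 * \<tau> 4 * tau_C \<tau> + \<tau> 7^2 * \<tau> 5 * tau_F \<tau>
     + X_nu * \<tau> 8 * \<tau> 7 * \<tau> 6 * \<tau> 4^2 + X_a * \<tau> 7 * \<tau> 6^3 * \<tau> 4))"
    by (intro regular_add regular_uminus regular_mult regular_power regular_params regular_tau_C
        regular_tau_F regular_tau7 regular_tau8) (simp_all add: regular_tau)
  then have "regular (\<lambda>\<tau>. \<tau> 9 * \<tau> 6^2 * (\<tau> 2 ^ 0 * \<tau> 3 ^ 0 * \<tau> 4 ^ 2))"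
    by (rule regular_cong) (simp add: conf_tau9[of _ X_a X_b X_nu] good_nonzero good_recurrence)
  then have *: "regular (\<lambda>\<tau>. \<tau> 9 * \<tau> 6^2)"
    by (rule regular_cancel)
  obtain m where "regular (\<lambda>\<tau>. \<tau> (8 + 1) * \<tau> 5 ^ m)"
    using regular_tau_shift_one[OF regular_tau8 regular_tau7] by blast
  then show ?thesis
    using regular_coprime_denominators[OF _ * prime_to_tau5_power[OF prime_to_tau5_tau6]] by simp
qed

lemma regular_tau10: "regular (\<lambda>\<tau>. \<tau> 10)"
proof -
  have "regular (\<lambda>\<tau>. - \<tau> 4 * (\<tau> 9^2 * \<tau> 6^4 + 2 * \<tau> 9 * \<tau> 8^2 * \<tau> 6^2 * \<tau> 5 + \<tau> 8^4 * \<tau> 5^2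
       + 2 * \<tau> 8^3 * \<tau> 7^2 * \<tau> 4
       + X_nu * (\<tau> 9 * \<tau> 8 * \<tau> 7 * \<tau> 6^3 + \<tau> 8^3 * \<tau> 7 * \<tau> 6 * \<tau> 5) + X_b * \<tau> 8^2 * \<tau> 7^2 * \<tau> 6^2)
     + \<tau> 8 * \<tau> 7^2 * (\<tau> 8^2 * \<tau> 4^2 + \<tau> 7^2 * tau_F \<tau>))"
    by (intro regular_add regular_uminus regular_mult regular_power regular_params regular_numeral
        regular_tau_F regular_tau7 regular_tau8 regular_tau9) (simp_all add: regular_tau)
  then have "regular (\<lambda>\<tau>. \<tau> 10 * \<tau> 7^2 * \<tau> 6^3 * \<tau> 4)"
    by (rule regular_cong) (rule conf_tau10; simp add: good_nonzero good_recurrence)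
  then have "regular (\<lambda>\<tau>. \<tau> 10 * (\<tau> 7^2 * \<tau> 6^3) * (\<tau> 2 ^ 0 * \<tau> 3 ^ 0 * \<tau> 4 ^ 1))"
    by (rule regular_cong) (simp add: mult_ac)
  then have *: "regular (\<lambda>\<tau>. \<tau> 10 * (\<tau> 7^2 * \<tau> 6^3))"
    by (rule regular_cancel)
  obtain m where "regular (\<lambda>\<tau>. \<tau> (9 + 1) * \<tau> 5 ^ m)"
    using regular_tau_shift_one[OF regular_tau9 regular_tau7] by blast
  then show ?thesis
    using regular_coprime_denominators[OF _ *] prime_to_tau5_power prime_to_tau5_mult
      prime_to_tau5_tau6 prime_to_tau5_tau7 by simp
qed

text \<open>The index 10 is the last entry of the window starting at 4, whose regularity the
  induction below needs.\<close>

lemma regular_tau_upto_10: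
  assumes "0 \<le> i" "i \<le> 10"
  shows "regular (\<lambda>\<tau>. \<tau> i)"
proof (cases "i \<le> 6")
  case True
  then show ?thesis using assms by (simp add: regular_tau)
next
  case False
  then have "i = 7 \<or> i = 8 \<or> i = 9 \<or> i = 10" using assms by linarith
  then show ?thesis
    using regular_tau7 regular_tau8 regular_tau9 regular_tau10 by blast
qed

lemma regular_tau_nonneg: "regular (\<lambda>\<tau>. \<tau> (int n))"
proof (induction n rule: less_induct)
  case (less n)
  show ?case
  proof (cases "n \<le> 10")
    case True
    then show ?thesis by (simp add: regular_tau_upto_10)
  next
    case False
    have "regular (\<lambda>\<tau>. \<tau> (int (n - 1)))"
      using False by (intro less) simp
    then obtain m where "regular (\<lambda>\<tau>. \<tau> (int (n - 1) + 1) * \<tau> 5 ^ m)"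
      using regular_tau_shift_one regular_tau7 by blast
    then have 1: "regular (\<lambda>\<tau>. \<tau> (int n) * \<tau> 5 ^ m)"
      using False by (simp add: of_nat_diff)
    have "regular (\<lambda>\<tau>. \<tau> (int (n - 4)))"
      using False by (intro less) simp
    moreover have "regular (\<lambda>\<tau>. \<tau> (i + 4))" if "0 \<le> i" "i \<le> 6" for i
      using that by (intro regular_tau_upto_10) simp_all
    ultimately obtain k where
      "regular (\<lambda>\<tau>. \<tau> (int (n - 4) + 4) * (\<tau> (2 + 4) * \<tau> (3 + 4) * \<tau> (4 + 4)) ^ k)"
      by (rule regular_shift)
    then have 2: "regular (\<lambda>\<tau>. \<tau> (int n) * (\<tau> 6 * \<tau> 7 * \<tau> 8) ^ k)"
      using False by (simp add: of_nat_diff)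
    show ?thesis
      by (rule regular_coprime_denominators[OF 1 2])
         (intro prime_to_tau5_power prime_to_tau5_mult prime_to_tau5_tau6 prime_to_tau5_tau7
           prime_to_tau5_tau8)
  qed
qed

section \<open>From regular functions to the subring \<open>laurent_ring\<close>\<close>

lemma subring_generated_add:
  assumes "x \<in> subring_generated S" "y \<in> subring_generated S"
  shows "x + y \<in> subring_generated S"
proof -
  have "0 \<in> subring_generated S"
    using subring_generated.diff[OF subring_generated.one subring_generated.one] by simp
  then have "x - (0 - y) \<in> subring_generated S"
    using assms by (intro subring_generated.diff)
  then show ?thesis by simp
qed

lemma subring_generated_power: "x \<in> subring_generated S \<Longrightarrow> x ^ n \<in> subring_generated S"
  by (induction n) (auto intro: subring_generated.intros)

lemma subring_generated_of_int: "of_int n \<in> subring_generated S"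
proof (induction n rule: int_induct[of _ 0])
  case base
  show ?case
    using subring_generated.diff[OF subring_generated.one subring_generated.one, of S] by simp
next
  case (step1 i)
  then show ?case by (auto intro: subring_generated_add subring_generated.one)
next
  case (step2 i)
  then show ?case by (auto intro: subring_generated.diff subring_generated.one)
qed

lemma X_in_laurent_ring:
  "X_a \<in> laurent_ring" "X_b \<in> laurent_ring" "X_nu \<in> laurent_ring"
  "X_tau0 \<in> laurent_ring" "X_tau1 \<in> laurent_ring" "X_tau2 \<in> laurent_ring" "X_tau3 \<in> laurent_ring"
  "X_tau4 \<in> laurent_ring" "X_tau5 \<in> laurent_ring" "X_tau6 \<in> laurent_ring"
  "inverse X_tau2 \<in> laurent_ring" "inverse X_tau3 \<in> laurent_ring" "inverse X_tau4 \<in> laurent_ring"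
  unfolding laurent_ring_def by (auto intro: subring_generated.gen)

text \<open>Stated for any good solution with a suitable window, so that it applies to the generic
  solution and to its reflection.\<close>

lemma regular_in_laurent_ring:
  assumes "regular f" "good \<tau>" and \<tau>: "\<And>i. 0 \<le> i \<Longrightarrow> i \<le> 6 \<Longrightarrow> \<tau> i \<in> laurent_ring"
    and inv: "inverse (\<tau> 2) \<in> laurent_ring" "inverse (\<tau> 3) \<in> laurent_ring" "inverse (\<tau> 4) \<in> laurent_ring"
  shows "f \<tau> \<in> laurent_ring"
proof -
  obtain p m where p: "f \<tau> * (\<tau> 2 * \<tau> 3 * \<tau> 4) ^ m = evX \<tau> p"
    using assms(1,2) unfolding regular_def by blast
  have "evX \<tau> p \<in> laurent_ring"
    using X_in_laurent_ring \<tau> unfolding laurent_ring_def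
    by (intro ev_closed[where Q = "\<lambda>f. f () \<in> subring_generated _" and \<tau> = "\<lambda>_. \<tau>"])
       (auto intro: subring_generated_add subring_generated.mult subring_generated_of_int)
  then have "evX \<tau> p * (inverse (\<tau> 2) * inverse (\<tau> 3) * inverse (\<tau> 4)) ^ m \<in> laurent_ring"
    using inv unfolding laurent_ring_def
    by (intro subring_generated.mult subring_generated_power)
  moreover have "evX \<tau> p * (inverse (\<tau> 2) * inverse (\<tau> 3) * inverse (\<tau> 4)) ^ m = f \<tau>"
    using good_nonzero[OF assms(2)] by (simp add: field_simps flip: p)
  ultimately show ?thesis by simp
qed

lemma to_fract_P_tau:
  "to_fract (P_tau 0) = X_tau0" "to_fract (P_tau 1) = X_tau1" "to_fract (P_tau 2) = X_tau2"
  "to_fract (P_tau 3) = X_tau3" "to_fract (P_tau 4) = X_tau4" "to_fract (P_tau 5) = X_tau5"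
  "to_fract (P_tau 6) = X_tau6"
  by (simp_all add: P_tau_def X_tau0_def X_tau1_def X_tau2_def X_tau3_def X_tau4_def X_tau5_def
      X_tau6_def)

theorem proposition2p3:
  shows "(\<exists>!\<tau>. tau_sequence \<tau>) \<and>
         (\<forall>\<tau>. tau_sequence \<tau> \<longrightarrow> (\<forall>n. \<tau> n \<in> laurent_ring))"
proof -
  obtain \<tau> where good: "good \<tau>" and init: "\<And>i. 0 \<le> i \<Longrightarrow> i \<le> 6 \<Longrightarrow> \<tau> i = to_fract (P_tau i)"
    using good_generic_exists by blast
  have seq: "tau_sequence \<tau>"
    using good_recurrence[OF good] by (simp add: tau_sequence_def init to_fract_P_tau)
  have unique: "\<sigma> = \<tau>" if \<sigma>: "tau_sequence \<sigma>" for \<sigma>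
  proof -
    have "\<tau> i = \<sigma> i" if "0 \<le> i" "i \<le> 6" for i
      using int_0_6_cases[OF that] seq \<sigma> unfolding tau_sequence_def by (elim disjE) simp_all
    then have "\<tau> = \<sigma>"
      using \<sigma> good_recurrence[OF good] good_nonzero[OF good]
      by (intro recurrence_unique[of X_a X_b X_nu]) (auto simp: tau_sequence_def)
    then show ?thesis by simp
  qed
  have window: "\<tau> i \<in> laurent_ring" if "0 \<le> i" "i \<le> 6" for i
    using int_0_6_cases[OF that] seq unfolding tau_sequence_def
    by (elim disjE) (simp_all add: X_in_laurent_ring)
  have inv: "inverse (\<tau> 2) \<in> laurent_ring" "inverse (\<tau> 3) \<in> laurent_ring"
    "inverse (\<tau> 4) \<in> laurent_ring"
    using seq unfolding tau_sequence_def by (simp_all add: X_in_laurent_ring)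
  have "\<tau> n \<in> laurent_ring" for n
  proof (cases "n \<ge> 0")
    case True
    then show ?thesis
      using regular_in_laurent_ring[OF regular_tau_nonneg[of "nat n"] good window inv] by simp
  next
    case False
    \<comment> \<open>Reflection permutes the window, exchanging \<open>\<tau> 2\<close> and
      \<open>\<tau> 4\<close> and fixing \<open>\<tau> 3\<close>, so the invertible entries stay in
      the middle.\<close>
    then show ?thesis
      using regular_in_laurent_ring[OF regular_tau_nonneg[of "nat (6 - n)"] good_reflect[OF good]]
        window inv by simp
  qed
  then show ?thesis
    using seq unique by blast
qed

end
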